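(* Let $p\in\mathbb{N}$ and let $\{\alpha_n\}_{n\ge 0}\subset\mathbb{D}$ satisfy $\alpha_{n+p}=\alpha_n$ for all $n\ge 0$. Let $\{\varphi_n\}$ and $\{\psi_n\}$ be the associated orthonormal polynomials and normalized second kind polynomials. Then for every integer $k\ge 0$ and every $s\in\{1,\ldots,p-1\}$, $$\varphi_{kp}(z)=z^{kp/2}\left[U_k\left(\frac{\Delta(z)}{2}\right)+\frac{\eta(z;1)}{2z^{p/2}}U_{k-1}\left(\frac{\Delta(z)}{2}\right)\right],$$ $$\varphi_{kp}^*(z)=z^{kp/2}\left[U_k\left(\frac{\Delta(z)}{2}\right)+\frac{\eta(z;-1)}{2z^{p/2}}U_{k-1}\left(\frac{\Delta(z)}{2}\right)\right],$$ $$\varphi_{kp+s}(z)=\frac{(\varphi_{s}(z)+\psi_s(z))\varphi_{kp}(z)+(\varphi_s(z)-\psi_s(z))\varphi_{kp}^*(z)}{2},$$ $$\varphi_{kp+s}^*(z)=\frac{(\varphi_s^*(z)-\psi_s^*(z))\varphi_{kp}(z)+(\varphi_s^*(z)+\psi_s^*(z))\varphi_{kp}^*(z)}{2},$$ where $U_{-1}=0$.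
   Context: $\mathbb{D}=\{z\in\mathbb{C}:|z|<1\}$. For a sequence $\{\alpha_n\}_{n\ge0}\subset\mathbb{D}$ (the Verblunsky coefficients of a unique probability measure $\mu$ on $\partial\mathbb{D}$ with infinite support), the monic orthogonal polynomials $\Phi_n$ of $\mu$ satisfy $\Phi_0=1$ and the Szegő recursion $\Phi_{n+1}(z)=z\Phi_n(z)-\bar\alpha_n\Phi_n^*(z)$, $\Phi_{n+1}^*(z)=\Phi_n^*(z)-\alpha_n z\Phi_n(z)$. For a polynomial $Q_n$ with index $n$ (such as $\Phi_n,\varphi_n,\psi_n$), $Q_n^*(z)=z^n\overline{Q_n(1/\bar z)}$. The second kind polynomials $\Psi_n$ are obtained from the same recursion with $\alpha_n$ replaced by $-\alpha_n$ and $\Psi_0=1$. The normalized polynomials are $\varphi_n=\Phi_n/\prod_{j=0}^{n-1}\sqrt{1-|\alpha_j|^2}$ (the orthonormal polynomials) and $\psi_n=\Psi_n/\prod_{j=0}^{n-1}\sqrt{1-|\alpha_j|^2}$. The discriminant is $\Delta(z)=\dfrac{\varphi_p(z)+\varphi_p^*(z)+\psi_p(z)+\psi_p^*(z)}{2z^{p/2}}$, and $\eta(z;\sigma)=\sigma(\varphi_p(z)-\varphi_p^*(z))-\psi_p(z)-\psi_p^*(z)$. $U_k$ is the Chebyshev polynomial of the second kind of degree $k$, $U_k(\cos t)=\sin((k+1)t)/\sin t$. If $p$ is odd, a single choice of $z^{1/2}$ is used consistently for all half-integer powers of $z$ ($z^{p/2}=(z^{1/2})^p$, $z^{kp/2}=(z^{1/2})^{kp}$).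 The first two right-hand sides are polynomials in $z$ after simplification, and are understood at $z=0$ in that sense. *)

theory Defs
  imports "HOL-Probability.Probability" "HOL-Computational_Algebra.Polynomial"
begin

section \<open>Orthogonal polynomials on the unit circle\<close>

definition circle_support :: "complex measure \<Rightarrow> complex set" where
  "circle_support \<mu> =
     {z \<in> sphere 0 1. \<forall>U. open U \<and> z \<in> U \<longrightarrow> emeasure \<mu> (U \<inter> sphere 0 1) > 0}"

text \<open>The measurable space is the circle itself with its Borel sets, not the plane.\<close>

definition nontrivial_circle_measure :: "complex measure \<Rightarrow> bool" where
  "nontrivial_circle_measure \<mu> \<longleftrightarrow>
     prob_space \<mu> \<and> sets \<mu> = sets (restrict_space borel (sphere 0 1)) \<and>
     infinite (circle_support \<mu>)"

definition is_monic_orthogonal :: "complex measure \<Rightarrow> nat \<Rightarrow> complex poly \<Rightarrow> bool" where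
  "is_monic_orthogonal \<mu> n P \<longleftrightarrow>
     degree P = n \<and> lead_coeff P = 1 \<and>
     (\<forall>j<n. (\<integral>z. cnj (z ^ j) * poly P z \<partial>\<mu>) = 0)"

definition monic_orthogonal :: "complex measure \<Rightarrow> nat \<Rightarrow> complex poly" where
  "monic_orthogonal \<mu> n = (THE P. is_monic_orthogonal \<mu> n P)"

text \<open>
  This is the Szego recursion \<open>\<Phi>\<^sub>n\<^sub>+\<^sub>1(z) = z \<Phi>\<^sub>n(z) - cnj \<alpha>\<^sub>n \<Phi>\<^sub>n\<^sup>*(z)\<close> read at \<open>z = 0\<close>,
  where \<open>\<Phi>\<^sub>n\<^sup>*(0) = 1\<close> because \<open>\<Phi>\<^sub>n\<close> is monic of degree \<open>n\<close>.
\<close>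

definition verblunsky :: "complex measure \<Rightarrow> nat \<Rightarrow> complex" where
  "verblunsky \<mu> n = - cnj (poly (monic_orthogonal \<mu> (Suc n)) 0)"

text \<open>
  \<open>star n Q\<close> is \<open>Q\<^sup>*\<close> for a polynomial \<open>Q\<close> with index \<open>n\<close>, i.e. the polynomial
  \<open>z\<^sup>n cnj (Q (1 / cnj z))\<close>.  It is given by its coefficients so that it is also right at
  \<open>z = 0\<close>, where the latter expression would use the convention \<open>1 / 0 = 0\<close>.
\<close>

definition star :: "nat \<Rightarrow> complex poly \<Rightarrow> complex poly" where
  "star n Q = (\<Sum>i\<le>n. monom (cnj (coeff Q (n - i))) i)"

lemma poly_star:
  assumes "degree Q \<le> n" "z \<noteq> 0"
  shows "poly (star n Q) z = z ^ n * cnj (poly Q (1 / cnj z))"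
proof -
  have "poly (star n Q) z = (\<Sum>i\<le>n. cnj (coeff Q (n - i)) * z ^ i)"
    by (simp add: star_def poly_sum poly_monom)
  also have "\<dots> = (\<Sum>i\<le>n. cnj (coeff Q i) * z ^ (n - i))"
    by (rule sum.reindex_bij_witness[of _ "\<lambda>i. n - i" "\<lambda>i. n - i"]) auto
  also have "\<dots> = (\<Sum>i\<le>n. z ^ n * (cnj (coeff Q i) * (1 / z) ^ i))"
    using assms(2) by (intro sum.cong) (auto simp: power_diff power_divide)
  also have "\<dots> = z ^ n * cnj (\<Sum>i\<le>n. coeff Q i * (1 / cnj z) ^ i)"
    by (simp add: sum_distrib_left)
  also have "(\<Sum>i\<le>n. coeff Q i * (1 / cnj z) ^ i) = poly Q (1 / cnj z)"
    unfolding poly_altdef using assms(1)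
    by (intro sum.mono_neutral_right) (auto simp: coeff_eq_0)
  finally show ?thesis .
qed

text \<open>The polynomials generated by the Szego recursion with coefficients \<open>\<alpha>\<close>.\<close>

primrec szego :: "(nat \<Rightarrow> complex) \<Rightarrow> nat \<Rightarrow> complex poly" where
  "szego \<alpha> 0 = 1"
| "szego \<alpha> (Suc n) = pCons 0 (szego \<alpha> n) - smult (cnj (\<alpha> n)) (star n (szego \<alpha> n))"

definition second_kind :: "(nat \<Rightarrow> complex) \<Rightarrow> nat \<Rightarrow> complex poly" where
  "second_kind \<alpha> = szego (\<lambda>n. - \<alpha> n)"

definition norm_factor :: "(nat \<Rightarrow> complex) \<Rightarrow> nat \<Rightarrow> real" where
  "norm_factor \<alpha> n = (\<Prod>j<n. sqrt (1 - (cmod (\<alpha> j))\<^sup>2))"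

definition orthonormal_poly :: "complex measure \<Rightarrow> nat \<Rightarrow> complex poly" where
  "orthonormal_poly \<mu> n =
     smult (1 / of_real (norm_factor (verblunsky \<mu>) n)) (monic_orthogonal \<mu> n)"

definition normalized_second_kind :: "(nat \<Rightarrow> complex) \<Rightarrow> nat \<Rightarrow> complex poly" where
  "normalized_second_kind \<alpha> n = smult (1 / of_real (norm_factor \<alpha> n)) (second_kind \<alpha> n)"


section \<open>Discriminant and Chebyshev polynomials\<close>

text \<open>
  The argument \<open>w\<close> is the chosen square root of \<open>z\<close>, so \<open>z = w\<^sup>2\<close> and \<open>z\<^bsup>p/2\<^esup> = w\<^sup>p\<close>.
\<close>

definition discriminant ::
    "(nat \<Rightarrow> complex poly) \<Rightarrow> (nat \<Rightarrow> complex poly) \<Rightarrow> nat \<Rightarrow> complex \<Rightarrow> complex" where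
  "discriminant \<phi> \<psi> p w =
     (poly (\<phi> p) (w\<^sup>2) + poly (star p (\<phi> p)) (w\<^sup>2) +
      poly (\<psi> p) (w\<^sup>2) + poly (star p (\<psi> p)) (w\<^sup>2)) / (2 * w ^ p)"

definition eta ::
    "(nat \<Rightarrow> complex poly) \<Rightarrow> (nat \<Rightarrow> complex poly) \<Rightarrow> nat \<Rightarrow> complex \<Rightarrow> complex \<Rightarrow> complex" where
  "eta \<phi> \<psi> p z \<sigma> =
     \<sigma> * (poly (\<phi> p) z - poly (star p (\<phi> p)) z) - poly (\<psi> p) z - poly (star p (\<psi> p)) z"

fun chebU_nat :: "nat \<Rightarrow> complex poly" where
  "chebU_nat 0 = 1"
| "chebU_nat (Suc 0) = [:0, 2:]"
| "chebU_nat (Suc (Suc n)) = [:0, 2:] * chebU_nat (Suc n) - chebU_nat n"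

definition chebU :: "int \<Rightarrow> complex poly" where
  "chebU k = (if k < 0 then 0 else chebU_nat (nat k))"

lemma chebU_nat_cos: "poly (chebU_nat k) (cos t) * sin t = sin (of_nat (k + 1) * t)"
proof (induction k rule: chebU_nat.induct)
  case 1
  show ?case by simp
next
  case 2
  show ?case using sin_double[of t] by (simp add: mult_ac)
next
  case (3 n)
  have "sin (of_nat (n + 3) * t) + sin (of_nat (n + 1) * t) = 2 * cos t * sin (of_nat (n + 2) * t)"
    using sin_add[of "of_nat (n + 2) * t" t] sin_diff[of "of_nat (n + 2) * t" t]
    by (simp add: algebra_simps)
  with 3 show ?case
    by (simp add: algebra_simps) 
qed

lemma chebU_cos:
  assumes "sin t \<noteq> 0"
  shows "poly (chebU (int k)) (cos t) = sin (of_nat (k + 1) * t) / sin t"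
  using chebU_nat_cos[of k t] assms by (simp add: chebU_def eq_divide_eq)

lemma degree_chebU: "degree (chebU (int k)) = k"
proof -
  have "degree (chebU_nat k) = k \<and> chebU_nat k \<noteq> 0" 
  proof (induction k rule: chebU_nat.induct)
    case (3 n)
    then have "degree ([:0, 2:] * chebU_nat (Suc n)) = n + 2"
      by (subst degree_mult_eq) auto
    moreover from this have "degree (chebU_nat (Suc (Suc n))) = n + 2"
      unfolding chebU_nat.simps diff_conv_add_uminus using 3
      by (subst degree_add_eq_left) auto
    ultimately show ?case by auto
  qed auto
  then show ?thesis by (simp add: chebU_def)
qed

end

theory Submission
  imports Defs
begin

text \<open>
  Write \<open>\<rho>\<^sub>n = sqrt (1 - \<bar>\<alpha>\<^sub>n\<bar>\<^sup>2)\<close>.  For fixed \<open>z\<close> the normalized Szego recursion says that the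
  vector \<open>(\<phi>\<^sub>n(z), \<phi>\<^sub>n\<^sup>*(z))\<close> is a solution of the two-dimensional linear recursion with matrix
  \<open>(1/\<rho>\<^sub>n) (z, - cnj \<alpha>\<^sub>n; - \<alpha>\<^sub>n z, 1)\<close> and initial value \<open>(1, 1)\<close>.  Changing the sign of all
  \<open>\<alpha>\<^sub>n\<close> amounts to conjugating these matrices by \<open>diag(1, -1)\<close>, so \<open>(\<psi>\<^sub>n(z), - \<psi>\<^sub>n\<^sup>*(z))\<close> is the
  solution with initial value \<open>(1, -1)\<close>.  These two solutions span the solution space, and
  expanding an arbitrary solution in them gives the transfer matrix
  \<open>T\<^sub>n = 1/2 (\<phi>\<^sub>n + \<psi>\<^sub>n, \<phi>\<^sub>n - \<psi>\<^sub>n; \<phi>\<^sub>n\<^sup>* - \<psi>\<^sub>n\<^sup>*, \<phi>\<^sub>n\<^sup>* + \<psi>\<^sub>n\<^sup>*)\<close>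
  (\<open>szego_flow_expand\<close>).  If \<open>\<alpha>\<close> has period \<open>p\<close>, the vectors at the indices \<open>kp, kp + 1, \<dots>\<close>
  again solve the recursion; this is \<open>T\<^sub>k\<^sub>p\<^sub>+\<^sub>s = T\<^sub>s T\<^sub>k\<^sub>p\<close>, which is the pair of identities for
  \<open>\<phi>\<^sub>k\<^sub>p\<^sub>+\<^sub>s\<close> and \<open>\<phi>\<^sub>k\<^sub>p\<^sub>+\<^sub>s\<^sup>*\<close>.

  With \<open>s = p\<close> it shows that \<open>(\<phi>\<^sub>k\<^sub>p, \<phi>\<^sub>k\<^sub>p\<^sup>*)\<close> is the orbit of \<open>(1, 1)\<close> under the single matrix
  \<open>T\<^sub>p\<close>.  Its trace is \<open>z\<^bsup>p/2\<^esup> \<Delta>(z)\<close> by definition, and its determinant is \<open>z\<^sup>p\<close>, because every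
  one-step matrix has determinant \<open>z\<close> (\<open>szego_flow_det\<close>).  By Cayley and Hamilton
  both components therefore satisfy \<open>X\<^sub>k\<^sub>+\<^sub>2 = W \<Delta> X\<^sub>k\<^sub>+\<^sub>1 - W\<^sup>2 X\<^sub>k\<close> with \<open>W = z\<^bsup>p/2\<^esup>\<close>, which after
  division by \<open>W\<^sup>k\<close> is the Chebyshev recursion (\<open>chebU_solves_recurrence\<close>).

  All this concerns polynomials generated by the recursion, while \<open>\<phi>\<^sub>n\<close> is defined by
  orthogonality.  That both agree is Szego's theorem (\<open>is_monic_orthogonal_szego\<close>):
  \<open>z \<Phi>\<^sub>n\<close> and \<open>\<Phi>\<^sub>n\<^sup>*\<close> are both orthogonal to \<open>z, \<dots>, z\<^sup>n\<close>, so some combination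
  \<open>z \<Phi>\<^sub>n - c \<Phi>\<^sub>n\<^sup>*\<close> is also orthogonal to \<open>1\<close>, and the value at \<open>0\<close> identifies \<open>c\<close> as \<open>cnj \<alpha>\<^sub>n\<close>.
\<close>

section \<open>Reversed polynomials\<close>

lemma coeff_star: "coeff (star n Q) i = (if i \<le> n then cnj (coeff Q (n - i)) else 0)"
  by (simp add: star_def coeff_sum)

lemma degree_star_le: "degree (star n Q) \<le> n"
  by (rule degree_le) (simp add: coeff_star)

lemma star_diff: "star n (P - Q) = star n P - star n Q"
  by (rule poly_eqI) (simp add: coeff_star)

lemma star_smult: "star n (smult c P) = smult (cnj c) (star n P)"
  by (rule poly_eqI) (simp add: coeff_star)

lemma star_Suc_pCons_0: "star (Suc n) (pCons 0 P) = star n P"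
  by (rule poly_eqI) (auto simp: coeff_star coeff_pCons Suc_diff_le split: nat.splits)

lemma star_Suc_star:
  assumes "degree P \<le> n"
  shows "star (Suc n) (star n P) = pCons 0 P"
  by (rule poly_eqI)
     (use assms in \<open>auto simp: coeff_star coeff_pCons coeff_eq_0 split: nat.splits\<close>)

text \<open>On the unit circle \<open>1 / cnj z = z\<close>, so \<open>Q\<^sup>*(z) = z\<^sup>n cnj (Q(z))\<close> there.\<close>

lemma poly_star_on_circle:
  assumes "degree Q \<le> n" "z \<in> sphere 0 1"
  shows "poly (star n Q) z = z ^ n * cnj (poly Q z)"
proof -
  have z: "z \<noteq> 0" "z * cnj z = 1"
    using assms(2) complex_norm_square[of z] by auto
  then have "1 / cnj z = z"
    by (metis complex_cnj_zero_iff nonzero_eq_divide_eq)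
  then show ?thesis
    using poly_star[OF assms(1) z(1)] by simp
qed

section \<open>Szego's recursion for orthogonal polynomials\<close>

lemma space_nontrivial_circle_measure:
  assumes "nontrivial_circle_measure \<mu>"
  shows "space \<mu> = sphere 0 1"
proof -
  have "sets \<mu> = sets (restrict_space borel (sphere 0 1))"
    using assms by (simp add: nontrivial_circle_measure_def)
  from sets_eq_imp_space_eq[OF this] show ?thesis
    by (simp add: space_restrict_space)
qed

lemma integrable_continuous_on_circle:
  fixes f :: "complex \<Rightarrow> complex"
  assumes \<mu>: "nontrivial_circle_measure \<mu>" and f: "continuous_on UNIV f"
  shows "integrable \<mu> f"
proof -
  interpret prob_space \<mu>
    using \<mu> by (simp add: nontrivial_circle_measure_def)
  have "f \<in> borel_measurable (restrict_space borel (sphere 0 1))"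
    by (rule measurable_restrict_space1, rule borel_measurable_continuous_onI, rule f)
  moreover have "sets \<mu> = sets (restrict_space borel (sphere 0 1))"
    using \<mu> by (simp add: nontrivial_circle_measure_def)
  ultimately have meas: "f \<in> borel_measurable \<mu>"
    using measurable_cong_sets by blast
  have "compact (f ` sphere 0 1)"
    by (intro compact_continuous_image continuous_on_subset[OF f]) auto
  then obtain B where B: "\<And>z. z \<in> sphere 0 1 \<Longrightarrow> norm (f z) \<le> B"
    using compact_imp_bounded bounded_iff by (metis imageI)
  show ?thesis
    by (rule integrable_const_bound[OF _ meas, of B])
       (use B space_nontrivial_circle_measure[OF \<mu>] in auto)
qed

text \<open>
  The inner product of \<open>L\<^sup>2(\<mu>)\<close> is definite on polynomials: if \<open>\<bar>Q\<bar>\<^sup>2\<close> has integral \<open>0\<close>, the open set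
  where \<open>Q\<close> does not vanish is a null set, so the infinite support of \<open>\<mu>\<close> consists of roots of \<open>Q\<close>.
\<close>

lemma poly_eq_0_of_norm_0:
  assumes \<mu>: "nontrivial_circle_measure \<mu>"
    and Q: "(\<integral>z. cnj (poly Q z) * poly Q z \<partial>\<mu>) = 0"
  shows "Q = 0"
proof (rule ccontr)
  assume "Q \<noteq> 0"
  have eq: "cnj (poly Q z) * poly Q z = complex_of_real ((cmod (poly Q z))\<^sup>2)" for z
    by (metis complex_norm_square mult.commute)
  have int_c: "integrable \<mu> (\<lambda>z. cnj (poly Q z) * poly Q z)"
    by (intro integrable_continuous_on_circle[OF \<mu>] continuous_intros)
  then have int: "integrable \<mu> (\<lambda>z. (cmod (poly Q z))\<^sup>2)"
    unfolding eq complex_of_real_integrable_eq .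
  have "(\<integral>z. (cmod (poly Q z))\<^sup>2 \<partial>\<mu>) = 0"
    using Q unfolding eq integral_complex_of_real by simp
  then have "AE z in \<mu>. (cmod (poly Q z))\<^sup>2 = 0"
    using integral_nonneg_eq_0_iff_AE[OF int] by simp
  then have ae: "AE z in \<mu>. poly Q z = 0"
    by simp
  let ?U = "{z. poly Q z \<noteq> 0}"
  have open_U: "open ?U"
    by (intro open_Collect_neq continuous_intros)
  have sets: "sets \<mu> = sets (restrict_space borel (sphere 0 1))"
    using \<mu> by (simp add: nontrivial_circle_measure_def)
  have "?U \<inter> sphere 0 1 \<in> sets \<mu>"
    unfolding sets using open_U by (auto simp: sets_restrict_space)
  moreover have "{z \<in> space \<mu>. \<not> poly Q z = 0} = ?U \<inter> sphere 0 1"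
    by (auto simp: space_nontrivial_circle_measure[OF \<mu>])
  ultimately have null: "emeasure \<mu> (?U \<inter> sphere 0 1) = 0"
    using ae by (rule AE_iff_measurable[THEN iffD1])
  have "circle_support \<mu> \<subseteq> {z. poly Q z = 0}"
    using null open_U by (fastforce simp: circle_support_def)
  then have "finite (circle_support \<mu>)"
    using poly_roots_finite[OF \<open>Q \<noteq> 0\<close>] finite_subset by blast
  then show False
    using \<mu> by (simp add: nontrivial_circle_measure_def)
qed

lemma poly_eq_0_of_orthogonal:
  assumes \<mu>: "nontrivial_circle_measure \<mu>" and deg: "degree Q \<le> n"
    and orth: "\<And>j. j \<le> n \<Longrightarrow> (\<integral>z. cnj (z ^ j) * poly Q z \<partial>\<mu>) = 0"
  shows "Q = 0"
proof (rule poly_eq_0_of_norm_0[OF \<mu>])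
  have "(\<integral>z. cnj (poly Q z) * poly Q z \<partial>\<mu>)
      = (\<integral>z. (\<Sum>j\<le>degree Q. cnj (coeff Q j) * (cnj (z ^ j) * poly Q z)) \<partial>\<mu>)"
    by (simp add: poly_altdef[of Q] sum_distrib_right mult.assoc)
  also have "\<dots> = (\<Sum>j\<le>degree Q. \<integral>z. cnj (coeff Q j) * (cnj (z ^ j) * poly Q z) \<partial>\<mu>)"
    by (intro Bochner_Integration.integral_sum integrable_continuous_on_circle[OF \<mu>]
        continuous_intros)
  also have "\<dots> = (\<Sum>j\<le>degree Q. cnj (coeff Q j) * (\<integral>z. cnj (z ^ j) * poly Q z \<partial>\<mu>))"
    by (simp only: integral_mult_right_zero)
  also have "\<dots> = 0"
    by (rule sum.neutral) (use orth deg in auto)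
  finally show "(\<integral>z. cnj (poly Q z) * poly Q z \<partial>\<mu>) = 0" .
qed

lemma is_monic_orthogonal_unique:
  assumes \<mu>: "nontrivial_circle_measure \<mu>"
    and P: "is_monic_orthogonal \<mu> n P" and Q: "is_monic_orthogonal \<mu> n Q"
  shows "P = Q"
proof (cases n)
  case 0
  then show ?thesis
    using P Q by (auto simp: is_monic_orthogonal_def elim!: degree_eq_zeroE)
next
  case (Suc m)
  have "degree (P - Q) \<le> m"
  proof (rule degree_le, intro allI impI)
    fix i assume "m < i"
    then consider "i = n" | "i > n"
      using Suc by linarith
    then show "coeff (P - Q) i = 0"
      by cases (use P Q in \<open>auto simp: is_monic_orthogonal_def coeff_eq_0\<close>)
  qed
  moreover have "(\<integral>z. cnj (z ^ j) * poly (P - Q) z \<partial>\<mu>) = 0" if "j \<le> m" for j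
  proof -
    have "integrable \<mu> (\<lambda>z. cnj (z ^ j) * poly R z)" for R
      by (intro integrable_continuous_on_circle[OF \<mu>] continuous_intros)
    then show ?thesis
      using P Q that Suc
      by (simp add: is_monic_orthogonal_def right_diff_distrib del: complex_cnj_power)
  qed
  ultimately have "P - Q = 0"
    by (rule poly_eq_0_of_orthogonal[OF \<mu>])
  then show ?thesis by simp
qed

lemma monic_orthogonal_eq:
  assumes "nontrivial_circle_measure \<mu>" "is_monic_orthogonal \<mu> n P"
  shows "monic_orthogonal \<mu> n = P"
  unfolding monic_orthogonal_def
  using assms is_monic_orthogonal_unique by blast

text \<open>
  On the circle \<open>cnj (z\<^sup>j) P\<^sup>*(z)\<close> is the conjugate of \<open>cnj (z\<^sup>n\<^sup>-\<^sup>j) P(z)\<close>, so reversal turns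
  orthogonality to \<open>1, \<dots>, z\<^sup>n\<^sup>-\<^sup>1\<close> into orthogonality to \<open>z, \<dots>, z\<^sup>n\<close>.
\<close>

lemma integral_star:
  assumes \<mu>: "nontrivial_circle_measure \<mu>" and deg: "degree P \<le> n" and j: "j \<le> n"
  shows "(\<integral>z. cnj (z ^ j) * poly (star n P) z \<partial>\<mu>)
       = cnj (\<integral>z. cnj (z ^ (n - j)) * poly P z \<partial>\<mu>)"
proof (subst Bochner_Integration.integral_cnj[symmetric],
    rule Bochner_Integration.integral_cong[OF refl])
  fix z assume "z \<in> space \<mu>"
  then have z: "z \<in> sphere 0 1"
    using space_nontrivial_circle_measure[OF \<mu>] by simp
  then have "cnj z * z = 1"
    using complex_norm_square[of z] by (simp add: mult.commute)
  then have "cnj (z ^ j) * z ^ j = 1"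
    by (metis complex_cnj_power power_mult_distrib power_one)
  moreover have "z ^ n = z ^ j * z ^ (n - j)"
    using j by (simp flip: power_add)
  ultimately have "cnj (z ^ j) * z ^ n = z ^ (n - j)"
    by (metis mult.assoc mult_1)
  then have "cnj (z ^ j) * (z ^ n * cnj (poly P z)) = z ^ (n - j) * cnj (poly P z)"
    by (metis mult.assoc)
  then show "cnj (z ^ j) * poly (star n P) z = cnj (cnj (z ^ (n - j)) * poly P z)"
    by (simp add: poly_star_on_circle[OF deg z])
qed

text \<open>
  The coefficient \<open>c\<close> solves \<open>\<langle>1, z P\<rangle> = c \<langle>1, P\<^sup>*\<rangle>\<close>.  It exists because \<open>\<langle>1, P\<^sup>*\<rangle>\<close> is the conjugate of
  \<open>\<langle>z\<^sup>n, P\<rangle>\<close>; if that vanished, \<open>P\<close> would be orthogonal to all polynomials of degree at most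
  \<open>n\<close>, itself included.
\<close>

lemma is_monic_orthogonal_Suc:
  assumes \<mu>: "nontrivial_circle_measure \<mu>" and P: "is_monic_orthogonal \<mu> n P"
  obtains c where "is_monic_orthogonal \<mu> (Suc n) (pCons 0 P - smult c (star n P))"
proof -
  have deg: "degree P = n" and lead: "coeff P n = 1"
    and orth: "\<And>j. j < n \<Longrightarrow> (\<integral>z. cnj (z ^ j) * poly P z \<partial>\<mu>) = 0"
    using P by (auto simp: is_monic_orthogonal_def)
  define S where "S = (\<integral>z. poly (star n P) z \<partial>\<mu>)"
  define c where "c = (\<integral>z. z * poly P z \<partial>\<mu>) / S"
  have "S = cnj (\<integral>z. cnj (z ^ n) * poly P z \<partial>\<mu>)"
    using integral_star[OF \<mu>, of P n 0] deg by (simp add: S_def)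
  moreover have "(\<integral>z. cnj (z ^ n) * poly P z \<partial>\<mu>) \<noteq> 0"
  proof
    assume "(\<integral>z. cnj (z ^ n) * poly P z \<partial>\<mu>) = 0"
    with orth have "P = 0"
      by (intro poly_eq_0_of_orthogonal[OF \<mu>, of P n]) (auto simp: deg le_less)
    with lead show False by simp
  qed
  ultimately have S: "S \<noteq> 0" by simp
  let ?Q = "pCons 0 P - smult c (star n P)"
  have lead_Q: "coeff ?Q (Suc n) = 1"
    using lead by (simp add: coeff_star)
  have "degree ?Q \<le> Suc n"
    by (rule degree_le) (auto simp: coeff_pCons coeff_star deg coeff_eq_0 split: nat.splits)
  with lead_Q have deg_Q: "degree ?Q = Suc n"
    by (intro antisym le_degree) auto
  have "(\<integral>z. cnj (z ^ j) * poly ?Q z \<partial>\<mu>) = 0" if j: "j < Suc n" for j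
  proof -
    have "(\<integral>z. cnj (z ^ j) * poly ?Q z \<partial>\<mu>)
        = (\<integral>z. cnj (z ^ j) * (z * poly P z) - c * (cnj (z ^ j) * poly (star n P) z) \<partial>\<mu>)"
      by (simp add: algebra_simps)
    also have "\<dots> = (\<integral>z. cnj (z ^ j) * (z * poly P z) \<partial>\<mu>)
        - (\<integral>z. c * (cnj (z ^ j) * poly (star n P) z) \<partial>\<mu>)"
      by (intro Bochner_Integration.integral_diff integrable_continuous_on_circle[OF \<mu>]
          continuous_intros)
    also have "\<dots> = (\<integral>z. cnj (z ^ j) * (z * poly P z) \<partial>\<mu>)
        - c * (\<integral>z. cnj (z ^ j) * poly (star n P) z \<partial>\<mu>)"
      by (simp only: integral_mult_right_zero)
    also have "\<dots> = 0"
    proof (cases j)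
      case 0
      then show ?thesis
        using S by (simp add: c_def flip: S_def)
    next
      case (Suc i)
      have "(\<integral>z. cnj (z ^ j) * (z * poly P z) \<partial>\<mu>) = (\<integral>z. cnj (z ^ i) * poly P z \<partial>\<mu>)"
      proof (rule Bochner_Integration.integral_cong[OF refl])
        fix z assume "z \<in> space \<mu>"
        then have "cnj z * z = 1"
          using space_nontrivial_circle_measure[OF \<mu>] complex_norm_square[of z]
          by (simp add: mult.commute)
        moreover have "cnj (z ^ j) * (z * poly P z) = (cnj z * z) * (cnj (z ^ i) * poly P z)"
          by (simp add: Suc mult_ac)
        ultimately show "cnj (z ^ j) * (z * poly P z) = cnj (z ^ i) * poly P z"
          by simp
      qed
      also have "\<dots> = 0"
        using orth j Suc by simp
      moreover have "(\<integral>z. cnj (z ^ j) * poly (star n P) z \<partial>\<mu>) = 0"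
        using integral_star[OF \<mu>, of P n j] orth[of "n - j"] deg j Suc by simp
      ultimately show ?thesis by simp
    qed
    finally show ?thesis .
  qed
  with deg_Q lead_Q have "is_monic_orthogonal \<mu> (Suc n) ?Q"
    by (simp add: is_monic_orthogonal_def)
  then show ?thesis by (rule that)
qed

theorem is_monic_orthogonal_szego:
  assumes \<mu>: "nontrivial_circle_measure \<mu>"
  shows "is_monic_orthogonal \<mu> n (szego (verblunsky \<mu>) n)"
proof (induction n)
  case 0
  show ?case by (simp add: is_monic_orthogonal_def)
next
  case (Suc n)
  let ?P = "szego (verblunsky \<mu>) n"
  obtain c where c: "is_monic_orthogonal \<mu> (Suc n) (pCons 0 ?P - smult c (star n ?P))"
    using is_monic_orthogonal_Suc[OF \<mu> Suc] .
  have "coeff ?P n = 1"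
    using Suc by (auto simp: is_monic_orthogonal_def)
  then have "poly (star n ?P) 0 = 1"
    by (simp add: poly_0_coeff_0 coeff_star)
  then have "c = cnj (verblunsky \<mu> n)"
    by (simp add: verblunsky_def monic_orthogonal_eq[OF \<mu> c])
  with c show ?case by simp
qed

section \<open>The linear recursion behind the polynomials\<close>

text \<open>
  The normalized Szego recursion at a fixed point \<open>z\<close>, for a pair of scalar sequences without
  prescribed initial values.
\<close>

definition szego_flow ::
    "(nat \<Rightarrow> complex) \<Rightarrow> complex \<Rightarrow> (nat \<Rightarrow> complex) \<Rightarrow> (nat \<Rightarrow> complex) \<Rightarrow> bool" where
  "szego_flow \<alpha> z x y \<longleftrightarrow> (\<forall>n.
     x (Suc n) = (z * x n - cnj (\<alpha> n) * y n) / of_real (sqrt (1 - (cmod (\<alpha> n))\<^sup>2)) \<and>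
     y (Suc n) = (y n - \<alpha> n * z * x n) / of_real (sqrt (1 - (cmod (\<alpha> n))\<^sup>2)))"

lemma szego_flow_shift:
  assumes "szego_flow \<alpha> z x y" and "\<And>n. \<alpha> (m + n) = \<alpha> n"
  shows "szego_flow \<alpha> z (\<lambda>n. x (m + n)) (\<lambda>n. y (m + n))"
  using assms unfolding szego_flow_def by (metis add_Suc_right)

lemma szego_flow_expand:
  assumes xy: "szego_flow \<alpha> z x y"
    and a: "szego_flow \<alpha> z a a'" "a 0 = 1" "a' 0 = 1"
    and b: "szego_flow (\<lambda>n. - \<alpha> n) z b b'" "b 0 = 1" "b' 0 = 1"
  shows "x n = ((a n + b n) * x 0 + (a n - b n) * y 0) / 2"
    and "y n = ((a' n - b' n) * x 0 + (a' n + b' n) * y 0) / 2"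
proof -
  have "x n = ((a n + b n) * x 0 + (a n - b n) * y 0) / 2 \<and>
        y n = ((a' n - b' n) * x 0 + (a' n + b' n) * y 0) / 2"
  proof (induction n)
    case 0
    show ?case using a b by simp
  next
    case (Suc n)
    define r where "r = inverse (complex_of_real (sqrt (1 - (cmod (\<alpha> n))\<^sup>2)))"
    have steps:
      "x (Suc n) = r * (z * x n - cnj (\<alpha> n) * y n)" "y (Suc n) = r * (y n - \<alpha> n * z * x n)"
      "a (Suc n) = r * (z * a n - cnj (\<alpha> n) * a' n)" "a' (Suc n) = r * (a' n - \<alpha> n * z * a n)"
      "b (Suc n) = r * (z * b n + cnj (\<alpha> n) * b' n)" "b' (Suc n) = r * (b' n + \<alpha> n * z * b n)"
      using xy a(1) b(1) by (simp_all add: szego_flow_def r_def divide_inverse mult.commute)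
    have IH: "x n = ((a n + b n) * x 0 + (a n - b n) * y 0) / 2"
      "y n = ((a' n - b' n) * x 0 + (a' n + b' n) * y 0) / 2"
      using Suc by auto
    show ?case
      unfolding steps IH by (simp add: field_simps)
  qed
  then show "x n = ((a n + b n) * x 0 + (a n - b n) * y 0) / 2"
    and "y n = ((a' n - b' n) * x 0 + (a' n + b' n) * y 0) / 2"
    by auto
qed

text \<open>
  Up to a factor, the left-hand side is the determinant with columns \<open>(a, a')\<close> and \<open>(b, - b')\<close>.
  One step multiplies it by \<open>(z - \<bar>\<alpha>\<^sub>n\<bar>\<^sup>2 z) / \<rho>\<^sub>n\<^sup>2 = z\<close>, the determinant of the one-step matrix.
\<close>

lemma szego_flow_det:
  assumes \<alpha>: "\<And>n. cmod (\<alpha> n) < 1"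
    and a: "szego_flow \<alpha> z a a'" "a 0 = 1" "a' 0 = 1"
    and b: "szego_flow (\<lambda>n. - \<alpha> n) z b b'" "b 0 = 1" "b' 0 = 1"
  shows "a n * b' n + a' n * b n = 2 * z ^ n"
proof (induction n)
  case 0
  show ?case using a b by simp
next
  case (Suc n)
  define r where "r = complex_of_real (sqrt (1 - (cmod (\<alpha> n))\<^sup>2))"
  have pos: "1 - (cmod (\<alpha> n))\<^sup>2 > 0"
    using \<alpha>[of n] by (simp add: power_less_one_iff abs_square_less_1)
  then have "r \<noteq> 0" by (simp add: r_def)
  have "r * r = 1 - \<alpha> n * cnj (\<alpha> n)"
    using pos complex_norm_square[of "\<alpha> n"] by (simp add: r_def flip: of_real_mult)
  have steps:
    "a (Suc n) = (z * a n - cnj (\<alpha> n) * a' n) / r" "a' (Suc n) = (a' n - \<alpha> n * z * a n) / r"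
    "b (Suc n) = (z * b n + cnj (\<alpha> n) * b' n) / r" "b' (Suc n) = (b' n + \<alpha> n * z * b n) / r"
    using a(1) b(1) by (simp_all add: szego_flow_def r_def)
  have "a (Suc n) * b' (Suc n) + a' (Suc n) * b (Suc n)
      = z * (1 - \<alpha> n * cnj (\<alpha> n)) * (a n * b' n + a' n * b n) / (r * r)"
    unfolding steps using \<open>r \<noteq> 0\<close> by (simp add: field_simps)
  also have "\<dots> = z * (a n * b' n + a' n * b n)"
    using \<open>r \<noteq> 0\<close> by (simp flip: \<open>r * r = _\<close>)
  finally show ?case
    using Suc by simp
qed

lemma degree_szego_le: "degree (szego \<alpha> n) \<le> n"
proof (induction n)
  case (Suc n)
  have "degree (pCons 0 (szego \<alpha> n)) \<le> Suc n"
    using Suc by (intro degree_pCons_le[THEN order_trans]) simp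
  moreover have "degree (smult (cnj (\<alpha> n)) (star n (szego \<alpha> n))) \<le> Suc n"
    using degree_star_le[of n "szego \<alpha> n"] by (intro degree_smult_le[THEN order_trans]) simp
  ultimately show ?case
    by (simp add: degree_diff_le)
qed simp

lemma star_szego_Suc:
  "star (Suc n) (szego \<alpha> (Suc n))
     = star n (szego \<alpha> n) - smult (\<alpha> n) (pCons 0 (szego \<alpha> n))"
  by (simp add: star_diff star_smult star_Suc_pCons_0 star_Suc_star degree_szego_le)

lemma szego_flow_szego:
  fixes \<alpha> z
  defines "P \<equiv> \<lambda>n. smult (1 / of_real (norm_factor \<alpha> n)) (szego \<alpha> n)"
  shows "szego_flow \<alpha> z (\<lambda>n. poly (P n) z) (\<lambda>n. poly (star n (P n)) z)"
  unfolding szego_flow_def P_def star_smult star_szego_Suc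
  by (simp add: norm_factor_def divide_inverse) (simp add: algebra_simps)

section \<open>Chebyshev polynomials and two-term recurrences\<close>

lemma chebU_Suc: "chebU (int (Suc k)) = [:0, 2:] * chebU (int k) - chebU (int k - 1)"
  by (cases k) (simp_all add: chebU_def nat_add_distrib)

text \<open>
  \<open>W\<^sup>k U\<^sub>k(t/2)\<close> and \<open>W\<^sup>k U\<^sub>k\<^sub>-\<^sub>1(t/2)\<close> both solve the recurrence, so it suffices to match
  the first two values, using \<open>U\<^sub>-\<^sub>1 = 0\<close>, \<open>U\<^sub>0 = 1\<close> and \<open>U\<^sub>1(t/2) = t\<close>.
\<close>

lemma chebU_solves_recurrence:
  fixes X :: "nat \<Rightarrow> complex"
  assumes "W \<noteq> 0" and rec: "\<And>k. X (Suc (Suc k)) = t * W * X (Suc k) - W\<^sup>2 * X k"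
  shows "X k = W ^ k * (poly (chebU (int k)) (t / 2) * X 0
    + (X 1 / W - t * X 0) * poly (chebU (int k - 1)) (t / 2))"
proof -
  define u where "u k = poly (chebU (int k)) (t / 2)" for k
  define v where "v k = poly (chebU (int k - 1)) (t / 2)" for k
  define d where "d = X 1 / W - t * X 0"
  define V where "V k = W ^ k * (u k * X 0 + d * v k)" for k
  have u_Suc: "u (Suc k) = t * u k - v k" for k
    unfolding u_def v_def by (simp only: chebU_Suc poly_diff poly_mult) simp
  have v_Suc: "v (Suc k) = u k" for k
    by (simp add: u_def v_def)
  have "X k = V k \<and> X (Suc k) = V (Suc k)"
  proof (induction k)
    case 0
    show ?case using \<open>W \<noteq> 0\<close> by (simp add: V_def u_def v_def d_def chebU_def field_simps)
  next
    case (Suc k)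
    have "V (Suc (Suc k)) = t * W * V (Suc k) - W\<^sup>2 * V k"
      unfolding V_def u_Suc v_Suc
      by (simp add: algebra_simps power2_eq_square)
    with Suc rec[of k] show ?case by simp
  qed
  then show ?thesis by (simp add: V_def u_def v_def d_def)
qed

text \<open>Cayley and Hamilton for a two-by-two matrix, applied along an orbit.\<close>

lemma linear_orbit_recurrence:
  fixes X Y :: "nat \<Rightarrow> 'a :: comm_ring_1"
  assumes "\<And>k. X (Suc k) = a * X k + b * Y k" and "\<And>k. Y (Suc k) = c * X k + d * Y k"
  shows "X (Suc (Suc k)) = (a + d) * X (Suc k) - (a * d - b * c) * X k"
    and "Y (Suc (Suc k)) = (a + d) * Y (Suc k) - (a * d - b * c) * Y k"
  by (simp_all add: assms algebra_simps)

section \<open>Periodic Verblunsky coefficients\<close>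

theorem theorem2p1:
  fixes p :: nat and \<alpha> :: "nat \<Rightarrow> complex" and \<mu> :: "complex measure"
    and \<phi> \<psi> :: "nat \<Rightarrow> complex poly"
  assumes "p \<ge> 1"
    and "\<And>n. cmod (\<alpha> n) < 1"
    and "\<And>n. \<alpha> (n + p) = \<alpha> n"
    and "nontrivial_circle_measure \<mu>"
    and "verblunsky \<mu> = \<alpha>"
    and "\<phi> = orthonormal_poly \<mu>"
    and "\<psi> = normalized_second_kind \<alpha>"
  shows "\<forall>k::nat.
      (\<exists>R. (\<forall>z w. z \<noteq> 0 \<and> w\<^sup>2 = z \<longrightarrow>
              poly R z = w ^ (k * p) *
                (poly (chebU (int k)) (discriminant \<phi> \<psi> p w / 2) +
                 eta \<phi> \<psi> p z 1 / (2 * w ^ p) *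
                   poly (chebU (int k - 1)) (discriminant \<phi> \<psi> p w / 2))) \<and>
           (\<forall>z. poly (\<phi> (k * p)) z = poly R z)) \<and>
      (\<exists>R. (\<forall>z w. z \<noteq> 0 \<and> w\<^sup>2 = z \<longrightarrow>
              poly R z = w ^ (k * p) *
                (poly (chebU (int k)) (discriminant \<phi> \<psi> p w / 2) +
                 eta \<phi> \<psi> p z (-1) / (2 * w ^ p) *
                   poly (chebU (int k - 1)) (discriminant \<phi> \<psi> p w / 2))) \<and>
           (\<forall>z. poly (star (k * p) (\<phi> (k * p))) z = poly R z)) \<and>
      (\<forall>s\<in>{1..p - 1}. \<forall>z.
         poly (\<phi> (k * p + s)) z =
           ((poly (\<phi> s) z + poly (\<psi> s) z) * poly (\<phi> (k * p)) z +
            (poly (\<phi> s) z - poly (\<psi> s) z) * poly (star (k * p) (\<phi> (k * p))) z) / 2 \<and>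
         poly (star (k * p + s) (\<phi> (k * p + s))) z =
           ((poly (star s (\<phi> s)) z - poly (star s (\<psi> s)) z) * poly (\<phi> (k * p)) z +
            (poly (star s (\<phi> s)) z + poly (star s (\<psi> s)) z) *
              poly (star (k * p) (\<phi> (k * p))) z) / 2)"
proof -
  note \<alpha> = assms(2) and per = assms(3) and \<mu> = assms(4)
  have \<phi>: "\<phi> = (\<lambda>n. smult (1 / of_real (norm_factor \<alpha> n)) (szego \<alpha> n))"
    using assms(5,6) monic_orthogonal_eq[OF \<mu> is_monic_orthogonal_szego[OF \<mu>]]
    by (auto simp: orthonormal_poly_def)
  have \<psi>: "\<psi> = (\<lambda>n. smult (1 / of_real (norm_factor (\<lambda>n. - \<alpha> n) n)) (szego (\<lambda>n. - \<alpha> n) n))"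
    using assms(7) by (auto simp: normalized_second_kind_def second_kind_def norm_factor_def)
  define a where "a z n = poly (\<phi> n) z" for z n
  define a' where "a' z n = poly (star n (\<phi> n)) z" for z n
  define b where "b z n = poly (\<psi> n) z" for z n
  define b' where "b' z n = poly (star n (\<psi> n)) z" for z n
  note defs = a_def a'_def b_def b'_def
  have flow_a: "szego_flow \<alpha> z (a z) (a' z)" for z
    unfolding a_def[abs_def] a'_def[abs_def] \<phi> by (rule szego_flow_szego)
  have flow_b: "szego_flow (\<lambda>n. - \<alpha> n) z (b z) (b' z)" for z
    unfolding b_def[abs_def] b'_def[abs_def] \<psi> by (rule szego_flow_szego)
  have init: "a z 0 = 1" "a' z 0 = 1" "b z 0 = 1" "b' z 0 = 1" for z
    by (simp_all add: defs \<phi> \<psi> norm_factor_def star_def)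

  have per_k: "\<alpha> (k * p + n) = \<alpha> n" for k n
  proof (induction k)
    case (Suc k)
    then show ?case using per[of "k * p + n"] by (simp add: ac_simps)
  qed simp
  have step: "a z (k * p + s) = ((a z s + b z s) * a z (k * p) + (a z s - b z s) * a' z (k * p)) / 2"
    and step': "a' z (k * p + s)
      = ((a' z s - b' z s) * a z (k * p) + (a' z s + b' z s) * a' z (k * p)) / 2"
    for z k s
    using szego_flow_expand[OF szego_flow_shift[OF flow_a per_k] flow_a init(1,2) flow_b init(3,4)]
    by simp_all

  have main: "a z (k * p) = w ^ (k * p) * (poly (chebU (int k)) (discriminant \<phi> \<psi> p w / 2) +
        eta \<phi> \<psi> p z 1 / (2 * w ^ p) * poly (chebU (int k - 1)) (discriminant \<phi> \<psi> p w / 2))"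
    and main': "a' z (k * p) = w ^ (k * p) * (poly (chebU (int k)) (discriminant \<phi> \<psi> p w / 2) +
        eta \<phi> \<psi> p z (-1) / (2 * w ^ p) * poly (chebU (int k - 1)) (discriminant \<phi> \<psi> p w / 2))"
    if z: "z \<noteq> 0" "w\<^sup>2 = z" for z w k
  proof -
    define W where "W = w ^ p"
    define t where "t = discriminant \<phi> \<psi> p w"
    define X where "X k = a z (k * p)" for k
    define Y where "Y k = a' z (k * p)" for k
    have W: "W \<noteq> 0" "W\<^sup>2 = z ^ p" "w ^ (k * p) = W ^ k"
      using z by (auto simp: W_def power_mult[symmetric] mult.commute)
    have t: "t = (a z p + a' z p + b z p + b' z p) / (2 * W)"
      by (simp add: t_def W_def discriminant_def defs z(2))
    have e: "eta \<phi> \<psi> p z 1 = a z p - a' z p - b z p - b' z p"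
      "eta \<phi> \<psi> p z (-1) = a' z p - a z p - b z p - b' z p"
      by (simp_all add: eta_def defs)
    let ?m = "(a z p + b z p) / 2" and ?n = "(a z p - b z p) / 2"
      and ?m' = "(a' z p - b' z p) / 2" and ?n' = "(a' z p + b' z p) / 2"
    have X_Suc: "X (Suc k) = ?m * X k + ?n * Y k"
      and Y_Suc: "Y (Suc k) = ?m' * X k + ?n' * Y k" for k
      using step[of z k p] step'[of z k p]
      by (simp_all add: X_def Y_def add_divide_distrib add.commute)
    \<comment> \<open>Trace and determinant of \<open>T\<^sub>p\<close>, whose rows are \<open>(?m, ?n)\<close> and \<open>(?m', ?n')\<close>.\<close>
    have trace: "?m + ?n' = t * W"
      using W by (simp add: t field_simps)
    have "?m * ?n' - ?n * ?m' = (a z p * b' z p + a' z p * b z p) / 2"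
      by (simp add: field_simps)
    also have "\<dots> = W\<^sup>2"
      using szego_flow_det[OF \<alpha> flow_a init(1,2) flow_b init(3,4)] W by simp
    finally have det: "?m * ?n' - ?n * ?m' = W\<^sup>2" .
    have rec: "X (Suc (Suc k)) = t * W * X (Suc k) - W\<^sup>2 * X k"
      "Y (Suc (Suc k)) = t * W * Y (Suc k) - W\<^sup>2 * Y k" for k
      using linear_orbit_recurrence[of X ?m ?n Y ?m' ?n', OF X_Suc Y_Suc]
      unfolding trace det by blast+
    have start: "X 0 = 1" "Y 0 = 1" "X 1 = a z p" "Y 1 = a' z p"
      by (simp_all add: X_def Y_def init)
    have "X 1 / W - t * X 0 = eta \<phi> \<psi> p z 1 / (2 * W)"
      "Y 1 / W - t * Y 0 = eta \<phi> \<psi> p z (-1) / (2 * W)"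
      unfolding start e t using W by (simp_all add: field_simps)
    with chebU_solves_recurrence[where X = X, OF W(1) rec(1)]
      chebU_solves_recurrence[where X = Y, OF W(1) rec(2)] start
    show "a z (k * p) = w ^ (k * p) * (poly (chebU (int k)) (discriminant \<phi> \<psi> p w / 2) +
        eta \<phi> \<psi> p z 1 / (2 * w ^ p) * poly (chebU (int k - 1)) (discriminant \<phi> \<psi> p w / 2))"
      and "a' z (k * p) = w ^ (k * p) * (poly (chebU (int k)) (discriminant \<phi> \<psi> p w / 2) +
        eta \<phi> \<psi> p z (-1) / (2 * w ^ p) * poly (chebU (int k - 1)) (discriminant \<phi> \<psi> p w / 2))"
      unfolding W(3) W_def[symmetric] t_def[symmetric] by (simp_all add: X_def Y_def)
  qed

  show ?thesis
  proof (intro allI conjI)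
    fix k
    \<comment> \<open>The simplified right-hand sides are the polynomials on the left themselves.\<close>
    show "\<exists>R. (\<forall>z w. z \<noteq> 0 \<and> w\<^sup>2 = z \<longrightarrow>
              poly R z = w ^ (k * p) *
                (poly (chebU (int k)) (discriminant \<phi> \<psi> p w / 2) +
                 eta \<phi> \<psi> p z 1 / (2 * w ^ p) *
                   poly (chebU (int k - 1)) (discriminant \<phi> \<psi> p w / 2))) \<and>
           (\<forall>z. poly (\<phi> (k * p)) z = poly R z)"
      using main unfolding defs by blast
    show "\<exists>R. (\<forall>z w. z \<noteq> 0 \<and> w\<^sup>2 = z \<longrightarrow>
              poly R z = w ^ (k * p) *
                (poly (chebU (int k)) (discriminant \<phi> \<psi> p w / 2) +
                 eta \<phi> \<psi> p z (-1) / (2 * w ^ p) *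
                   poly (chebU (int k - 1)) (discriminant \<phi> \<psi> p w / 2))) \<and>
           (\<forall>z. poly (star (k * p) (\<phi> (k * p))) z = poly R z)"
      using main' unfolding defs by blast
  qed (use step step' in \<open>unfold defs, blast\<close>)
qed

end
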